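(* Let $\rho_\pm>0$ and $u_\pm\in\mathbb{R}$ be constants with $u_+<u_-$. For each $\gamma\in(1,2)$ for which the Riemann solution with data $(\rho_\pm,u_\pm)$ contains two shocks $S_1$ and $S_2$ (i.e. $(\rho_+,u_+)\in IV(\rho_-,u_-)$), let $(\rho_\gamma(t,x),u_\gamma(t,x))$ be this two-shock Riemann solution of $$\rho_t+(\rho u)_x=0,\qquad u_t+\Big(\frac{u^2}{2}+\frac{\gamma-1}{4}\rho^{\gamma-1}\Big)_x=0,$$ as defined in the context. Put $\sigma=\frac12(u_-+u_+)$ and let $S=\{(t,\sigma t):0\le t<+\infty\}$. Then, as $\gamma\to1$, $(\rho_\gamma,u_\gamma)$ converges in the sense of distributions to $$(\rho(t,x),u(t,x))=(\rho_0(t,x)+w(t)\delta_S,\;u_0(t,x)),$$ where the singular part of $\rho$ is a $\delta$-measure on $S$ with weight $w(t)=t(\sigma[\rho]-[\rho u])$, with $[\rho]=\rho_+-\rho_-$ and $[\rho u]=\rho_+u_+-\rho_-u_-$, and $$\rho_0(t,x)=\begin{cases}\rho_-,&x<\sigma t,\\ \rho_+,&x>\sigma t,\end{cases}\qquad u_0(t,x)=\begin{cases}u_-,&x<\sigma t,\\ \sigma,&x=\sigma t,\\ u_+,&x>\sigma t.\end{cases}$$ That is, for every $\varphi\in C_0^\infty([0,+\infty)\times\mathbb{R})$, $$\lim_{\gamma\to1}\int_0^{+\infty}\!\!\int_{-\infty}^{+\infty}\rho_\gamma\varphi\,dx\,dt=\int_0^{+\infty}\!\!\int_{-\infty}^{+\infty}\rho_0\varphi\,dx\,dt+\int_0^{+\infty}w(t)\varphi(t,\sigma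 t)\,dt,$$ $$\lim_{\gamma\to1}\int_0^{+\infty}\!\!\int_{-\infty}^{+\infty}u_\gamma\varphi\,dx\,dt=\int_0^{+\infty}\!\!\int_{-\infty}^{+\infty}u_0\varphi\,dx\,dt.$$
   Context: Fix $\gamma\in(1,2)$. The Riemann problem has initial data $(\rho,u)(0,x)=(\rho_-,u_-)$ for $x<0$ and $(\rho_+,u_+)$ for $x>0$. Shock curves. For a left state $(\rho_l,u_l)$ with $\rho_l>0$: $S_1(\rho_l,u_l)$ is the set of $(\rho,u)$ with $\rho>\rho_l$, $u<u_l$ and $$u=u_l-\sqrt{\frac{\frac{\gamma-1}{2}(\rho^{\gamma-1}-\rho_l^{\gamma-1})}{(\rho+\rho_l)(\rho-\rho_l)}}\,(\rho-\rho_l);$$ $S_2(\rho_l,u_l)$ is the set of $(\rho,u)$ with $0<\rho<\rho_l$, $u<u_l$ and $$u=u_l+\sqrt{\frac{\frac{\gamma-1}{2}(\rho^{\gamma-1}-\rho_l^{\gamma-1})}{(\rho+\rho_l)(\rho-\rho_l)}}\,(\rho-\rho_l).$$ Region $IV(\rho_-,u_-)$ is the set of states $(\rho,u)$ with $\rho>0$ lying strictly on the smaller-$u$ side of the curves $S_1(\rho_-,u_-)$ (when $\rho>\rho_-$) and $S_2(\rho_-,u_-)$ (when $\rho<\rho_-$), with $u<u_-$ when $\rho=\rho_-$. If $(\rho_+,u_+)\in IV(\rho_-,u_-)$, there is a unique intermediate state $(\rho_*,u_* )$ (depending on $\gamma$) with $(\rho_*,u_* )\in S_1(\rho_-,u_-)$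 and $(\rho_+,u_+)\in S_2(\rho_*,u_* )$; in particular $\rho_*>\max\{\rho_-,\rho_+\}$ and $u_+<u_*<u_-$. The shock speeds are $$\sigma_1=\frac{\rho_*u_*-\rho_-u_-}{\rho_*-\rho_-},\qquad \sigma_2=\frac{\rho_+u_+-\rho_*u_*}{\rho_+-\rho_*},$$ and the two-shock Riemann solution is $$(\rho_\gamma,u_\gamma)(t,x)=\begin{cases}(\rho_-,u_-),&x<\sigma_1t,\\(\rho_*,u_* ),&\sigma_1t<x<\sigma_2t,\\(\rho_+,u_+),&x>\sigma_2t.\end{cases}$$ The weighted delta function $w(t)\delta_S$ on $S=\{(t,\sigma t):t\ge0\}$ acts on test functions $\varphi\in C_0^\infty([0,+\infty)\times\mathbb{R})$ by $\langle w(t)\delta_S,\varphi\rangle=\int_0^{+\infty}w(t)\varphi(t,\sigma t)\,dt$. *)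

theory Defs
  imports "HOL-Analysis.Analysis"
begin

(* States are pairs (density, velocity). *)

definition shock_slope :: "real \<Rightarrow> real \<Rightarrow> real \<Rightarrow> real" where
  "shock_slope \<gamma> \<rho>l \<rho> =
     sqrt ((\<gamma> - 1) / 2 * (\<rho> powr (\<gamma> - 1) - \<rho>l powr (\<gamma> - 1)) / ((\<rho> + \<rho>l) * (\<rho> - \<rho>l)))"

definition S1_curve :: "real \<Rightarrow> real \<times> real \<Rightarrow> real \<Rightarrow> real" where
  "S1_curve \<gamma> = (\<lambda>(\<rho>l, ul) \<rho>. ul - shock_slope \<gamma> \<rho>l \<rho> * (\<rho> - \<rho>l))"

definition S2_curve :: "real \<Rightarrow> real \<times> real \<Rightarrow> real \<Rightarrow> real" where
  "S2_curve \<gamma> = (\<lambda>(\<rho>l, ul) \<rho>. ul + shock_slope \<gamma> \<rho>l \<rho> * (\<rho> - \<rho>l))"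

definition S1 :: "real \<Rightarrow> real \<times> real \<Rightarrow> (real \<times> real) set" where
  "S1 \<gamma> = (\<lambda>(\<rho>l, ul). {(\<rho>, u). \<rho> > \<rho>l \<and> u < ul \<and> u = S1_curve \<gamma> (\<rho>l, ul) \<rho>})"

definition S2 :: "real \<Rightarrow> real \<times> real \<Rightarrow> (real \<times> real) set" where
  "S2 \<gamma> = (\<lambda>(\<rho>l, ul). {(\<rho>, u). 0 < \<rho> \<and> \<rho> < \<rho>l \<and> u < ul \<and> u = S2_curve \<gamma> (\<rho>l, ul) \<rho>})"

definition region_IV :: "real \<Rightarrow> real \<times> real \<Rightarrow> (real \<times> real) set" where
  "region_IV \<gamma> = (\<lambda>(\<rho>m, um). {(\<rho>, u). \<rho> > 0 \<and>
     (\<rho> > \<rho>m \<longrightarrow> u < S1_curve \<gamma> (\<rho>m, um) \<rho>) \<and>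
     (\<rho> < \<rho>m \<longrightarrow> u < S2_curve \<gamma> (\<rho>m, um) \<rho>) \<and>
     (\<rho> = \<rho>m \<longrightarrow> u < um)})"

(* Meaningful when the right state lies in region_IV of the left state; the state is then unique. *)
definition intermediate_state :: "real \<Rightarrow> real \<times> real \<Rightarrow> real \<times> real \<Rightarrow> real \<times> real" where
  "intermediate_state \<gamma> L R = (THE M. M \<in> S1 \<gamma> L \<and> R \<in> S2 \<gamma> M)"

definition shock_speed :: "real \<times> real \<Rightarrow> real \<times> real \<Rightarrow> real" where
  "shock_speed = (\<lambda>(\<rho>l, ul) (\<rho>r, ur). (\<rho>r * ur - \<rho>l * ul) / (\<rho>r - \<rho>l))"

(* The values on the two shock lines themselves (a null set) are a convention. *)
definition two_shock_solution ::
    "real \<Rightarrow> real \<times> real \<Rightarrow> real \<times> real \<Rightarrow> real \<Rightarrow> real \<Rightarrow> real \<times> real" where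
  "two_shock_solution \<gamma> L R t x =
     (let M = intermediate_state \<gamma> L R in
      if x < shock_speed L M * t then L
      else if x < shock_speed M R * t then M
      else R)"

(* k-times continuous differentiability relative to S; on the boundary of a closed half-plane
   the derivatives are the one-sided ones. *)
primrec Ck_on :: "nat \<Rightarrow> 'a::euclidean_space set \<Rightarrow> ('a \<Rightarrow> real) \<Rightarrow> bool" where
  "Ck_on 0 S f \<longleftrightarrow> continuous_on S f"
| "Ck_on (Suc k) S f \<longleftrightarrow>
     (\<exists>D. (\<forall>x\<in>S. (f has_derivative D x) (at x within S)) \<and> (\<forall>v. Ck_on k S (\<lambda>x. D x v)))"

definition half_plane :: "(real \<times> real) set" where
  "half_plane = {0..} \<times> UNIV"

(* The support is compact in the closed half-plane: test functions need not vanish at t = 0. *)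
definition test_functions :: "(real \<times> real \<Rightarrow> real) set" where
  "test_functions = {\<phi>. (\<forall>k. Ck_on k half_plane \<phi>) \<and> compact (closure {p \<in> half_plane. \<phi> p \<noteq> 0})}"

definition fun_pairing :: "(real \<Rightarrow> real \<Rightarrow> real) \<Rightarrow> (real \<times> real \<Rightarrow> real) \<Rightarrow> real" where
  "fun_pairing f \<phi> = (LBINT t:{0..}. (LBINT x. f t x * \<phi> (t, x)))"

definition delta_pairing :: "(real \<Rightarrow> real) \<Rightarrow> real \<Rightarrow> (real \<times> real \<Rightarrow> real) \<Rightarrow> real" where
  "delta_pairing w \<sigma> \<phi> = (LBINT t:{0..}. w t * \<phi> (t, \<sigma> * t))"

end

theory Submission
  imports Defs "HOL-Real_Asymp.Real_Asymp"
begin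

text \<open>Across either shock the velocity drops by an amount \<open>jump\<close> that is strictly increasing in the
  intermediate density, so the intermediate density is determined by the two drops summing to
  \<open>um - up\<close>. For a fixed density this sum tends to 0 as \<open>\<gamma>\<close> tends to 1, hence the intermediate
  density blows up; the two drops then become equal and both shock speeds tend to \<open>\<sigma>\<close>.
  The Rankine--Hugoniot conditions keep the mass per unit time between the shocks bounded, with
  limit \<open>\<sigma>[\<rho>] - [\<rho>u]\<close>, and this mass concentrates on the line \<open>x = \<sigma> t\<close>.\<close>

section \<open>The velocity drop across a shock\<close>

text \<open>This is \<open>shock_slope\<close> times the absolute density difference, with that
  difference moved under the root. The singular quotient by \<open>r - a\<close> disappears and the
  two densities enter symmetrically, so one function serves both shock families.\<close>

definition jump :: "real \<Rightarrow> real \<Rightarrow> real \<Rightarrow> real" where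
  "jump \<gamma> a r = sqrt ((\<gamma> - 1) / 2 * (r powr (\<gamma> - 1) - a powr (\<gamma> - 1)) * ((r - a) / (r + a)))"

text \<open>Lets the second shock, whose left state is the unknown intermediate one, be written with
  the known right density as the parameter.\<close>

lemma jump_commute: "jump \<gamma> a r = jump \<gamma> r a"
proof -
  have "(r powr (\<gamma> - 1) - a powr (\<gamma> - 1)) * ((r - a) / (r + a))
      = (a powr (\<gamma> - 1) - r powr (\<gamma> - 1)) * ((a - r) / (a + r))"
    by (simp add: add.commute divide_inverse algebra_simps)
  then show ?thesis by (simp only: jump_def mult.assoc)
qed

lemma jump_refl [simp]: "jump \<gamma> a a = 0"
  by (simp add: jump_def)

lemma shock_slope_eq_jump:
  assumes "a > 0" "r > 0"
  shows "shock_slope \<gamma> a r * \<bar>r - a\<bar> = jump \<gamma> a r"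
proof (cases "r = a")
  case False
  \<comment> \<open>The absolute value is the root of the square, and \<open>sqrt\<close> is
    multiplicative on all reals, so the factor can be taken under the root.\<close>
  have "shock_slope \<gamma> a r * \<bar>r - a\<bar> =
      sqrt ((\<gamma> - 1) / 2 * (r powr (\<gamma> - 1) - a powr (\<gamma> - 1)) / ((r + a) * (r - a)) * (r - a)\<^sup>2)"
    by (simp only: shock_slope_def real_sqrt_mult real_sqrt_abs)
  also have "(\<gamma> - 1) / 2 * (r powr (\<gamma> - 1) - a powr (\<gamma> - 1)) / ((r + a) * (r - a)) * (r - a)\<^sup>2
      = (\<gamma> - 1) / 2 * (r powr (\<gamma> - 1) - a powr (\<gamma> - 1)) * ((r - a) / (r + a))"
    using False assms by (simp add: power2_eq_square)
  finally show ?thesis by (simp add: jump_def)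
qed (simp add: jump_def)

lemma S1_curve_eq_jump:
  assumes "a > 0" "r \<ge> a"
  shows "S1_curve \<gamma> (a, u) r = u - jump \<gamma> a r"
  using shock_slope_eq_jump[of a r \<gamma>] assms by (simp add: S1_curve_def)

lemma S2_curve_eq_jump:
  assumes "r > 0" "r \<le> a"
  shows "S2_curve \<gamma> (a, u) r = u - jump \<gamma> a r"
proof -
  have "shock_slope \<gamma> a r * (r - a) = - (shock_slope \<gamma> a r * \<bar>r - a\<bar>)"
    using assms by (simp add: abs_if algebra_simps)
  then show ?thesis
    using shock_slope_eq_jump[of a r \<gamma>] assms by (simp add: S2_curve_def)
qed

text \<open>Both boundary curves, and the point \<open>r = a\<close> where the drop vanishes, merge
  into a single inequality.\<close>

lemma region_IV_iff_jump:
  assumes "a > 0" "r > 0"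
  shows "(r, v) \<in> region_IV \<gamma> (a, u) \<longleftrightarrow> v < u - jump \<gamma> a r"
  using assms by (cases r a rule: linorder_cases)
    (auto simp: region_IV_def S1_curve_eq_jump S2_curve_eq_jump)

text \<open>Licenses squaring \<open>jump\<close> back to its radicand in
  \<open>tendsto_jump_half\<close>.\<close>

lemma jump_radicand_nonneg:
  fixes \<gamma> :: real
  assumes "\<gamma> > 1" "0 < a" "a \<le> r"
  shows "0 \<le> (\<gamma> - 1) / 2 * (r powr (\<gamma> - 1) - a powr (\<gamma> - 1)) * ((r - a) / (r + a))"
  using assms by (intro mult_nonneg_nonneg) (auto intro: powr_mono2)

text \<open>Beyond \<open>a\<close>, the power difference and the quotient are nonnegative and
  strictly increasing in the density; hence so is their product.\<close>

lemma jump_strict_mono: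
  assumes "\<gamma> > 1" "0 < a" "a \<le> r" "r < s"
  shows "jump \<gamma> a r < jump \<gamma> a s"
proof -
  have "(r powr (\<gamma> - 1) - a powr (\<gamma> - 1)) * ((r - a) / (r + a))
      < (s powr (\<gamma> - 1) - a powr (\<gamma> - 1)) * ((s - a) / (s + a))"
  proof (rule mult_strict_mono')
    show "r powr (\<gamma> - 1) - a powr (\<gamma> - 1) < s powr (\<gamma> - 1) - a powr (\<gamma> - 1)"
      using assms by (auto intro!: powr_less_mono2)
    \<comment> \<open>Cross-multiplying the two quotients leaves twice this inequality.\<close>
    have "a * r < a * s" using assms by simp
    then show "(r - a) / (r + a) < (s - a) / (s + a)"
      using assms by (simp add: divide_simps) (simp add: algebra_simps)
  qed (use assms in \<open>auto intro: powr_mono2\<close>)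
  then have "(\<gamma> - 1) / 2 * ((r powr (\<gamma> - 1) - a powr (\<gamma> - 1)) * ((r - a) / (r + a)))
      < (\<gamma> - 1) / 2 * ((s powr (\<gamma> - 1) - a powr (\<gamma> - 1)) * ((s - a) / (s + a)))"
    using assms by (intro mult_strict_left_mono) auto
  then show ?thesis
    unfolding jump_def mult.assoc by (rule real_sqrt_less_mono)
qed

lemma jump_pos:
  assumes "\<gamma> > 1" "0 < a" "a < r"
  shows "0 < jump \<gamma> a r"
  using jump_strict_mono[of \<gamma> a a r] assms by simp

lemma continuous_on_jump:
  assumes "\<gamma> > 1" "0 < a" "0 < l"
  shows "continuous_on {l..h} (jump \<gamma> a)"
  unfolding jump_def using assms by (intro continuous_intros) auto

lemma filterlim_jump_at_top:
  assumes "\<gamma> > 1" "0 < a"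
  shows "filterlim (jump \<gamma> a) at_top at_top"
proof -
  have "filterlim (\<lambda>r. (\<gamma> - 1) / 2 * (r powr (\<gamma> - 1) - a powr (\<gamma> - 1)) * ((r - a) / (r + a)))
      at_top at_top"
    using assms by real_asymp
  then show ?thesis
    unfolding jump_def by (rule filterlim_compose[OF sqrt_at_top])
qed

text \<open>The factor \<open>\<gamma> - 1\<close> and the power difference both vanish at
  \<open>\<gamma> = 1\<close>. This serves twice: it puts the data into region IV for
  \<open>\<gamma>\<close> near 1, and it shows that a bounded intermediate density cannot carry the
  fixed total drop.\<close>

lemma tendsto_jump_at_right_1:
  assumes "a > 0" "r > 0"
  shows "((\<lambda>\<gamma>. jump \<gamma> a r) \<longlongrightarrow> 0) (at_right 1)"
proof -
  have "((\<lambda>\<gamma>. (\<gamma> - 1) / 2 * (r powr (\<gamma> - 1) - a powr (\<gamma> - 1)) * ((r - a) / (r + a)))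
      \<longlongrightarrow> (1 - 1) / 2 * (r powr (1 - 1) - a powr (1 - 1)) * ((r - a) / (r + a))) (at_right 1)"
    using assms by (intro tendsto_intros) auto
  then show ?thesis
    unfolding jump_def using tendsto_real_sqrt by fastforce
qed

section \<open>Existence and uniqueness of the intermediate state\<close>

text \<open>The first curve expresses \<open>u\<close> through \<open>r\<close>, and substitution
  into the second leaves one scalar equation for \<open>r\<close>. The strict velocity inequalities
  in \<open>S1\<close> and \<open>S2\<close> follow from positivity of the drops.\<close>

lemma intermediate_state_iff:
  assumes "\<gamma> > 1" "\<rho>m > 0" "\<rho>p > 0"
  shows "(r, u) \<in> S1 \<gamma> (\<rho>m, um) \<and> (\<rho>p, up) \<in> S2 \<gamma> (r, u) \<longleftrightarrow>
    r > max \<rho>m \<rho>p \<and> u = um - jump \<gamma> \<rho>m r \<and> jump \<gamma> \<rho>m r + jump \<gamma> \<rho>p r = um - up"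
  using assms jump_pos[of \<gamma> \<rho>m r] jump_pos[of \<gamma> \<rho>p r] jump_commute[of \<gamma> \<rho>p r]
  by (auto simp: S1_def S2_def S1_curve_eq_jump S2_curve_eq_jump)

text \<open>The scalar equation for the density is solved by the intermediate value theorem, and
  strict monotonicity makes the root unique.\<close>

lemma ex1_intermediate_state:
  assumes "\<gamma> > 1" "\<rho>m > 0" "\<rho>p > 0" and R: "(\<rho>p, up) \<in> region_IV \<gamma> (\<rho>m, um)"
  shows "\<exists>!M. M \<in> S1 \<gamma> (\<rho>m, um) \<and> (\<rho>p, up) \<in> S2 \<gamma> M"
proof -
  define J where "J = (\<lambda>r. jump \<gamma> \<rho>m r + jump \<gamma> \<rho>p r)"
  define c where "c = max \<rho>m \<rho>p"
  have c: "c > 0" "c \<ge> \<rho>m" "c \<ge> \<rho>p" using assms by (auto simp: c_def)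
  have mono: "J r < J s" if "c \<le> r" "r < s" for r s
    using that c assms unfolding J_def by (intro add_strict_mono jump_strict_mono) auto
  have lim: "filterlim J at_top at_top"
    unfolding J_def using assms by (intro filterlim_at_top_add_at_top filterlim_jump_at_top)
  \<comment> \<open>At the larger of the two given densities one drop is zero and the other is the
    drop between the data, so region IV says exactly that \<open>J\<close> starts below the required
    total.\<close>
  have "J c = jump \<gamma> \<rho>m \<rho>p"
    using jump_commute[of \<gamma> \<rho>m \<rho>p] by (auto simp: J_def c_def max_def)
  then have Jc: "J c < um - up" using R assms by (simp add: region_IV_iff_jump)
  have "eventually (\<lambda>r. J r \<ge> um - up \<and> r \<ge> c) at_top"
    using lim by (intro eventually_conj eventually_ge_at_top) (simp add: filterlim_at_top)
  then obtain b where b: "J b \<ge> um - up" "b \<ge> c"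
    using eventually_happens'[OF trivial_limit_at_top_linorder] by blast
  have "continuous_on {c..b} J"
    unfolding J_def using assms c by (intro continuous_intros continuous_on_jump)
  from IVT'[of J c "um - up" b, OF less_imp_le[OF Jc] b this]
  obtain r where r: "c \<le> r" "J r = um - up" by auto
  with Jc have "c < r" by (cases "r = c") auto
  have iff: "(s, u) \<in> S1 \<gamma> (\<rho>m, um) \<and> (\<rho>p, up) \<in> S2 \<gamma> (s, u) \<longleftrightarrow>
      s > c \<and> u = um - jump \<gamma> \<rho>m s \<and> J s = um - up" for s u
    using intermediate_state_iff[of \<gamma> \<rho>m \<rho>p s u um up] assms by (simp add: J_def c_def)
  show ?thesis
  proof (rule ex1I[of _ "(r, um - jump \<gamma> \<rho>m r)"])
    show "(r, um - jump \<gamma> \<rho>m r) \<in> S1 \<gamma> (\<rho>m, um) \<and> (\<rho>p, up) \<in> S2 \<gamma> (r, um - jump \<gamma> \<rho>m r)"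
      using r \<open>c < r\<close> by (simp add: iff)
    fix M assume M: "M \<in> S1 \<gamma> (\<rho>m, um) \<and> (\<rho>p, up) \<in> S2 \<gamma> M"
    obtain s u where [simp]: "M = (s, u)" by (cases M)
    have s: "s > c" "u = um - jump \<gamma> \<rho>m s" "J s = um - up" using M by (simp_all add: iff)
    then have "s = r"
      using mono[of s r] mono[of r s] r by (cases s r rule: linorder_cases) auto
    then show "M = (r, um - jump \<gamma> \<rho>m r)" using s by simp
  qed
qed

lemma intermediate_state_spec:
  assumes "\<gamma> > 1" "\<rho>m > 0" "\<rho>p > 0" "(\<rho>p, up) \<in> region_IV \<gamma> (\<rho>m, um)"
  defines "r \<equiv> fst (intermediate_state \<gamma> (\<rho>m, um) (\<rho>p, up))"
  shows "r > max \<rho>m \<rho>p" "jump \<gamma> \<rho>m r + jump \<gamma> \<rho>p r = um - up"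
    "snd (intermediate_state \<gamma> (\<rho>m, um) (\<rho>p, up)) = um - jump \<gamma> \<rho>m r"
proof -
  define u where "u = snd (intermediate_state \<gamma> (\<rho>m, um) (\<rho>p, up))"
  have M: "intermediate_state \<gamma> (\<rho>m, um) (\<rho>p, up) = (r, u)" by (simp add: r_def u_def)
  have "(r, u) \<in> S1 \<gamma> (\<rho>m, um) \<and> (\<rho>p, up) \<in> S2 \<gamma> (r, u)"
    using theI'[OF ex1_intermediate_state[OF assms(1-4)]]
    by (simp only: M flip: intermediate_state_def)
  then show "r > max \<rho>m \<rho>p" "jump \<gamma> \<rho>m r + jump \<gamma> \<rho>p r = um - up"
    "snd (intermediate_state \<gamma> (\<rho>m, um) (\<rho>p, up)) = um - jump \<gamma> \<rho>m r"
    using intermediate_state_iff[of \<gamma> \<rho>m \<rho>p r u um up] assms(1-3)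
    by (simp_all only: M) auto
qed

section \<open>Asymptotics of the intermediate state as \<gamma> tends to 1\<close>

text \<open>At a fixed density \<open>k\<close> the sum of the drops eventually falls below
  \<open>d\<close>. The sum increases with the density and equals \<open>d\<close> at
  \<open>r \<gamma>\<close>, so \<open>r \<gamma>\<close> cannot stay below \<open>k\<close>. The
  filter \<open>F\<close> is general because the limit is later taken along those \<gamma> for which
  the data lie in region IV.\<close>

lemma intermediate_density_at_top:
  assumes F: "F \<le> at_right 1" and pos: "a > 0" "b > 0" "d > 0"
    and r: "\<forall>\<^sub>F \<gamma> in F. r \<gamma> > max a b \<and> jump \<gamma> a (r \<gamma>) + jump \<gamma> b (r \<gamma>) = d"
  shows "filterlim r at_top F"
  unfolding filterlim_at_top
proof
  fix K :: real
  \<comment> \<open>The maximum makes \<open>k\<close> positive even when \<open>K\<close> is not,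
    as the limit of the drops at \<open>k\<close> requires.\<close>
  define k where "k = max K (max a b)"
  have k: "k > 0" "k \<ge> a" "k \<ge> b" using pos by (auto simp: k_def)
  have "((\<lambda>\<gamma>. jump \<gamma> a k + jump \<gamma> b k) \<longlongrightarrow> 0 + 0) (at_right 1)"
    using pos k by (intro tendsto_intros tendsto_jump_at_right_1)
  then have "((\<lambda>\<gamma>. jump \<gamma> a k + jump \<gamma> b k) \<longlongrightarrow> 0) F"
    using F by (auto intro: tendsto_mono)
  then have 1: "\<forall>\<^sub>F \<gamma> in F. jump \<gamma> a k + jump \<gamma> b k < d"
    using pos by (auto dest: order_tendstoD)
  have 2: "\<forall>\<^sub>F \<gamma> in F. \<gamma> > 1"
    using F by (rule filter_leD) (simp add: eventually_at_right_less)
  show "\<forall>\<^sub>F \<gamma> in F. K \<le> r \<gamma>"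
    using r 1 2
  proof eventually_elim
    case (elim \<gamma>)
    show ?case
    proof (rule ccontr)
      assume "\<not> K \<le> r \<gamma>"
      then have "r \<gamma> < k" by (simp add: k_def)
      then have "jump \<gamma> a (r \<gamma>) + jump \<gamma> b (r \<gamma>) < jump \<gamma> a k + jump \<gamma> b k"
        using elim pos by (intro add_strict_mono jump_strict_mono) auto
      with elim show False by simp
    qed
  qed
qed

text \<open>The squares of the two jumps differ by a vanishing amount, while their sum stays fixed.\<close>

lemma tendsto_jump_half:
  assumes F: "F \<le> at_right 1" and pos: "a > 0" "b > 0" "d > 0"
    and r: "\<forall>\<^sub>F \<gamma> in F. r \<gamma> > max a b \<and> jump \<gamma> a (r \<gamma>) + jump \<gamma> b (r \<gamma>) = d"
  shows "((\<lambda>\<gamma>. jump \<gamma> a (r \<gamma>)) \<longlongrightarrow> d / 2) F"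
proof -
  define J where "J = (\<lambda>c \<gamma>. jump \<gamma> c (r \<gamma>))"
  \<comment> \<open>\<open>P\<close> is twice the density term of the flux in the velocity equation.
    For fixed \<open>c\<close> it tends to 0, whereas \<open>P (r \<gamma>) \<gamma>\<close> will
    cancel in a difference.\<close>
  define P where "P = (\<lambda>c \<gamma> :: real. (\<gamma> - 1) / 2 * c powr (\<gamma> - 1))"
  have top: "filterlim r at_top F" by (rule intermediate_density_at_top[OF assms])
  have F1: "\<forall>\<^sub>F \<gamma> in F. \<gamma> > 1"
    using F by (rule filter_leD) (simp add: eventually_at_right_less)
  have id: "((\<lambda>\<gamma>. \<gamma>) \<longlongrightarrow> 1) F"
    using F by (rule tendsto_mono) (rule tendsto_ident_at)
  have P0: "(P c \<longlongrightarrow> 0) F" if "c > 0" for c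
  proof -
    have "(P c \<longlongrightarrow> (1 - 1) / 2 * c powr (1 - 1)) F"
      unfolding P_def using that by (intro tendsto_intros id) auto
    then show ?thesis by simp
  qed
  have ev: "\<forall>\<^sub>F \<gamma> in F. 0 \<le> J c \<gamma> \<and> J c \<gamma> \<le> d \<and>
      (J c \<gamma>)\<^sup>2 = (P (r \<gamma>) \<gamma> - P c \<gamma>) * ((r \<gamma> - c) / (r \<gamma> + c)) \<and> r \<gamma> > c" if "c \<in> {a, b}" for c
    using r F1
  proof eventually_elim
    case (elim \<gamma>)
    have "0 \<le> (\<gamma> - 1) / 2 * (r \<gamma> powr (\<gamma> - 1) - c powr (\<gamma> - 1)) * ((r \<gamma> - c) / (r \<gamma> + c))"
      using elim that pos by (intro jump_radicand_nonneg) auto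
    then have "(J c \<gamma>)\<^sup>2 = (P (r \<gamma>) \<gamma> - P c \<gamma>) * ((r \<gamma> - c) / (r \<gamma> + c))"
      by (simp add: J_def jump_def P_def right_diff_distrib)
    moreover have "0 \<le> J a \<gamma>" "0 \<le> J b \<gamma>"
      using elim pos by (auto simp: J_def intro!: less_imp_le[OF jump_pos])
    ultimately show ?case using elim that by (auto simp: J_def)
  qed
  \<comment> \<open>Since \<open>(r + c) / (r - c) = 1 + 2 * c / (r - c)\<close>, this is the error
    in taking the squared drop for \<open>P (r \<gamma>) \<gamma> - P c \<gamma>\<close>. It
    vanishes because the drops are bounded by \<open>d\<close> and the density blows up.\<close>
  have E: "((\<lambda>\<gamma>. (J c \<gamma>)\<^sup>2 * (2 * c / (r \<gamma> - c))) \<longlongrightarrow> 0) F" if c: "c \<in> {a, b}" for c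
  proof (rule Lim_null_comparison)
    show "\<forall>\<^sub>F \<gamma> in F. norm ((J c \<gamma>)\<^sup>2 * (2 * c / (r \<gamma> - c))) \<le> d\<^sup>2 * (2 * c / (r \<gamma> - c))"
      using ev[OF c]
    proof eventually_elim
      case (elim \<gamma>)
      then have "(J c \<gamma>)\<^sup>2 \<le> d\<^sup>2" by (intro power_mono) auto
      moreover have "0 \<le> 2 * c / (r \<gamma> - c)" using elim c pos by auto
      moreover from this have "norm ((J c \<gamma>)\<^sup>2 * (2 * c / (r \<gamma> - c))) = (J c \<gamma>)\<^sup>2 * (2 * c / (r \<gamma> - c))"
        by (simp only: real_norm_def abs_of_nonneg mult_nonneg_nonneg zero_le_power2)
      ultimately show ?case by (simp only: mult_right_mono)
    qed
    have "((\<lambda>x. d\<^sup>2 * (2 * c / (x - c))) \<longlongrightarrow> 0) at_top" by real_asymp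
    then show "((\<lambda>\<gamma>. d\<^sup>2 * (2 * c / (r \<gamma> - c))) \<longlongrightarrow> 0) F"
      using top by (rule filterlim_compose)
  qed
  \<comment> \<open>The expression is an exact formula for \<open>J a \<gamma>\<close>: if
    \<open>X + Y = d\<close>, then \<open>X = (d + (X * X - Y * Y) / d) / 2\<close>. The numerator
    over \<open>d\<close> is the difference of squares with \<open>P (r \<gamma>) \<gamma>\<close>
    eliminated.\<close>
  have "((\<lambda>\<gamma>. (d + ((P b \<gamma> - P a \<gamma>) - (J a \<gamma>)\<^sup>2 * (2 * a / (r \<gamma> - a))
      + (J b \<gamma>)\<^sup>2 * (2 * b / (r \<gamma> - b))) / d) / 2) \<longlongrightarrow> (d + ((0 - 0) - 0 + 0) / d) / 2) F"
    using pos by (intro tendsto_intros P0 E) auto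
  then have "((\<lambda>\<gamma>. (d + ((P b \<gamma> - P a \<gamma>) - (J a \<gamma>)\<^sup>2 * (2 * a / (r \<gamma> - a))
      + (J b \<gamma>)\<^sup>2 * (2 * b / (r \<gamma> - b))) / d) / 2) \<longlongrightarrow> d / 2) F" by simp
  moreover have "\<forall>\<^sub>F \<gamma> in F. (d + ((P b \<gamma> - P a \<gamma>) - (J a \<gamma>)\<^sup>2 * (2 * a / (r \<gamma> - a))
      + (J b \<gamma>)\<^sup>2 * (2 * b / (r \<gamma> - b))) / d) / 2 = J a \<gamma>"
    using ev[of a, simplified] ev[of b, simplified] r
  proof eventually_elim
    case (elim \<gamma>)
    have *: "(J c \<gamma>)\<^sup>2 + (J c \<gamma>)\<^sup>2 * (2 * c / (r \<gamma> - c)) = P (r \<gamma>) \<gamma> - P c \<gamma>"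
      if "(J c \<gamma>)\<^sup>2 = (P (r \<gamma>) \<gamma> - P c \<gamma>) * ((r \<gamma> - c) / (r \<gamma> + c))" "r \<gamma> > c" "c > 0" for c
    proof -
      have "(J c \<gamma>)\<^sup>2 + (J c \<gamma>)\<^sup>2 * (2 * c / (r \<gamma> - c)) = (J c \<gamma>)\<^sup>2 * ((r \<gamma> + c) / (r \<gamma> - c))"
        using that(2) by (simp add: divide_simps) (simp add: algebra_simps)
      then show ?thesis using that by simp
    qed
    have "(P b \<gamma> - P a \<gamma>) - (J a \<gamma>)\<^sup>2 * (2 * a / (r \<gamma> - a)) + (J b \<gamma>)\<^sup>2 * (2 * b / (r \<gamma> - b))
        = (J a \<gamma>)\<^sup>2 - (J b \<gamma>)\<^sup>2"
    proof -
      have "(J a \<gamma>)\<^sup>2 + (J a \<gamma>)\<^sup>2 * (2 * a / (r \<gamma> - a)) = P (r \<gamma>) \<gamma> - P a \<gamma>"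
        "(J b \<gamma>)\<^sup>2 + (J b \<gamma>)\<^sup>2 * (2 * b / (r \<gamma> - b)) = P (r \<gamma>) \<gamma> - P b \<gamma>"
        by (rule *; use elim pos in simp)+
      then show ?thesis by linarith
    qed
    also have "\<dots> = d * (J a \<gamma> - J b \<gamma>)"
      using elim by (auto simp: J_def power2_eq_square algebra_simps)
    finally show ?case using elim pos by (auto simp: J_def)
  qed
  ultimately show ?thesis
    unfolding J_def by (rule Lim_transform_eventually)
qed

section \<open>Shock speeds and the mass between the shocks\<close>

text \<open>The speed is the intermediate velocity plus \<open>(v - u) * (a / (r - a))\<close>, and
  this correction dies out as the density blows up.\<close>

lemma tendsto_shock_speed:
  assumes "filterlim r at_top F" "(v \<longlongrightarrow> s) F"
  shows "((\<lambda>\<gamma>. shock_speed (a, u) (r \<gamma>, v \<gamma>)) \<longlongrightarrow> s) F"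
proof -
  have lim: "((\<lambda>\<gamma>. a / (r \<gamma> - a)) \<longlongrightarrow> 0) F"
    by (rule filterlim_compose[OF _ assms(1)]) real_asymp
  have "((\<lambda>\<gamma>. v \<gamma> + (v \<gamma> - u) * (a / (r \<gamma> - a))) \<longlongrightarrow> s + (s - u) * 0) F"
    by (intro tendsto_intros assms lim)
  then have "((\<lambda>\<gamma>. v \<gamma> + (v \<gamma> - u) * (a / (r \<gamma> - a))) \<longlongrightarrow> s) F" by simp
  moreover have "\<forall>\<^sub>F \<gamma> in F. r \<gamma> > a"
    using assms(1) by (auto simp: filterlim_at_top_dense)
  then have "\<forall>\<^sub>F \<gamma> in F. v \<gamma> + (v \<gamma> - u) * (a / (r \<gamma> - a)) = shock_speed (a, u) (r \<gamma>, v \<gamma>)"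
    by eventually_elim (simp add: shock_speed_def field_simps)
  ultimately show ?thesis by (rule Lim_transform_eventually)
qed

text \<open>Lets the second shock, with the diverging density on its left, reuse
  \<open>tendsto_shock_speed\<close>.\<close>

lemma shock_speed_commute: "shock_speed L R = shock_speed R L"
  by (cases L; cases R) (simp add: shock_speed_def, metis minus_diff_eq minus_divide_divide)

text \<open>The Rankine--Hugoniot conditions of the two shocks, added up.\<close>

lemma shock_sector_mass:
  assumes "r \<noteq> a" "r \<noteq> b"
  shows "r * (shock_speed (r, v) (b, up) - shock_speed (a, um) (r, v)) =
    shock_speed (r, v) (b, up) * b - shock_speed (a, um) (r, v) * a - (b * up - a * um)"
proof -
  have "shock_speed (a, um) (r, v) * (r - a) = r * v - a * um"
    "shock_speed (r, v) (b, up) * (b - r) = b * up - r * v"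
    using assms by (simp_all add: shock_speed_def)
  then show ?thesis by (simp add: algebra_simps)
qed

section \<open>Test functions and integrals over time slices\<close>

text \<open>Values of \<phi> outside the half-plane are arbitrary, so \<phi> is replaced by its
  extension by zero. The extension may jump across \<open>t = 0\<close>, which is why continuity is
  claimed in \<open>x\<close> for each fixed \<open>t\<close>.\<close>

lemma test_function_extension:
  assumes "\<phi> \<in> test_functions"
  obtains T C where "T > 0" "C > 0"
    "(\<lambda>p. indicator half_plane p * \<phi> p) \<in> borel_measurable borel"
    "\<And>t x. \<bar>indicator half_plane (t, x) * \<phi> (t, x)\<bar> \<le> C * indicator {0..T} t * indicator {-T..T} x"
    "\<And>t. continuous_on UNIV (\<lambda>x. indicator half_plane (t, x) * \<phi> (t, x))"
proof -
  define K where "K = closure {p \<in> half_plane. \<phi> p \<noteq> 0}"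
  have "Ck_on 0 half_plane \<phi>" "compact K"
    using assms by (auto simp: test_functions_def K_def simp del: Ck_on.simps)
  then have cont: "continuous_on half_plane \<phi>" by simp
  have closed: "closed half_plane" unfolding half_plane_def by (intro closed_Times) auto
  \<comment> \<open>Closedness of the half-plane keeps the support where \<phi> is continuous, so
    \<phi> is bounded on it.\<close>
  have "K \<subseteq> half_plane" unfolding K_def by (rule closure_minimal[OF _ closed]) auto
  then have "compact (\<phi> ` K)"
    using cont \<open>compact K\<close> by (intro compact_continuous_image) (auto intro: continuous_on_subset)
  then obtain C where C: "C > 0" "\<And>p. p \<in> K \<Longrightarrow> \<bar>\<phi> p\<bar> \<le> C"
    using bounded_pos[of "\<phi> ` K"] compact_imp_bounded by auto
  obtain T where T: "T > 0" "\<And>p. p \<in> K \<Longrightarrow> norm p \<le> T"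
    using bounded_pos[of K] compact_imp_bounded[OF \<open>compact K\<close>] by auto
  show thesis
  proof (rule that[OF T(1) C(1)])
    show "(\<lambda>p. indicator half_plane p * \<phi> p) \<in> borel_measurable borel"
      using borel_measurable_continuous_on_indicator[OF borel_closed[OF closed] cont]
      by (simp only: real_scaleR_def)
    show "\<bar>indicator half_plane (t, x) * \<phi> (t, x)\<bar> \<le> C * indicator {0..T} t * indicator {-T..T} x"
      for t x :: real
    proof (cases "(t, x) \<in> half_plane \<and> \<phi> (t, x) \<noteq> 0")
      case True
      then have p: "(t, x) \<in> K" unfolding K_def by (intro subsetD[OF closure_subset]) auto
      have "\<bar>t\<bar> \<le> T" "\<bar>x\<bar> \<le> T"
        using order_trans[OF norm_fst_le T(2)[OF p]] order_trans[OF norm_snd_le T(2)[OF p]] by simp_all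
      moreover have "t \<ge> 0" using True by (simp add: half_plane_def)
      ultimately show ?thesis using True C(2)[OF p] by (simp add: abs_le_iff)
    next
      case False
      then have eq: "indicator half_plane (t, x) * \<phi> (t, x) = 0" by auto
      show ?thesis unfolding eq using C(1) by (simp add: indicator_def)
    qed
    show "continuous_on UNIV (\<lambda>x. indicator half_plane (t, x) * \<phi> (t, x))" for t :: real
    proof (cases "t \<ge> 0")
      case True
      then have "continuous_on UNIV (\<lambda>x. \<phi> (t, x))"
        by (intro continuous_on_compose2[OF cont] continuous_intros) (auto simp: half_plane_def)
      then show ?thesis using True by (simp add: half_plane_def)
    qed (simp add: half_plane_def)
  qed
qed

text \<open>The substitution \<open>x = (a + (b - a) * y) * t\<close> maps the slice of the sector
  to a fixed interval and releases the factor \<open>b - a\<close> that balances a diverging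
  density.\<close>

lemma sector_integral_rescale:
  fixes g :: "real \<Rightarrow> real"
  assumes "a < b" "t > 0"
  shows "(LBINT x. indicator {a * t..<b * t} x * g x) =
    (b - a) * t * (LBINT y. indicator {0..<1} y * g ((a + (b - a) * y) * t))"
proof -
  have c: "(b - a) * t > 0" using assms by simp
  have "(LBINT x. indicator {a * t..<b * t} x * g x) =
      \<bar>(b - a) * t\<bar> *\<^sub>R (LBINT y. indicator {a * t..<b * t} (a * t + (b - a) * t * y) *
        g (a * t + (b - a) * t * y))"
    using assms by (intro lborel_integral_real_affine) auto
  also have "(\<lambda>y. indicator {a * t..<b * t} (a * t + (b - a) * t * y) * g (a * t + (b - a) * t * y))
      = (\<lambda>y. indicator {0..<1} y * g ((a + (b - a) * y) * t))"
  proof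
    fix y :: real
    have "a * t + (b - a) * t * y < b * t \<longleftrightarrow> (b - a) * t * y < (b - a) * t * 1"
      by (simp add: algebra_simps)
    also have "\<dots> \<longleftrightarrow> y < 1" using c by (rule mult_less_cancel_left_pos)
    finally have "a * t + (b - a) * t * y < b * t \<longleftrightarrow> y < 1" .
    moreover have "a * t \<le> a * t + (b - a) * t * y \<longleftrightarrow> 0 \<le> y"
      using mult_le_cancel_left_pos[OF c, of 0 y] by simp
    moreover have "a * t + (b - a) * t * y = (a + (b - a) * y) * t"
      by (simp add: algebra_simps)
    ultimately show "indicator {a * t..<b * t} (a * t + (b - a) * t * y) * g (a * t + (b - a) * t * y)
        = indicator {0..<1} y * g ((a + (b - a) * y) * t)"
      by (simp add: indicator_def)
  qed
  finally show ?thesis using c assms by simp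
qed

lemma integrable_bounded_interval:
  fixes g :: "real \<Rightarrow> real"
  assumes [measurable]: "g \<in> borel_measurable borel"
    and "\<And>x. \<bar>g x\<bar> \<le> C * indicator {-T..T} x"
  shows "integrable lborel g"
proof (rule Bochner_Integration.integrable_bound)
  show "integrable lborel (\<lambda>x::real. C * indicator {-T..T} x)"
    by (intro integrable_mult_right integrable_real_indicator) (auto simp: emeasure_lborel_Icc_eq)
  show "AE x in lborel. norm (g x) \<le> norm (C * indicator {-T..T} x :: real)"
    using assms(2) by (intro AE_I2) (metis abs_ge_self order_trans real_norm_def)
qed simp

lemma abs_integral_bounded_interval:
  fixes g :: "real \<Rightarrow> real"
  assumes "g \<in> borel_measurable borel"
    and "\<And>x. \<bar>g x\<bar> \<le> C * indicator {-T..T} x" "T > 0"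
  shows "\<bar>LBINT x. g x\<bar> \<le> C * (2 * T)"
proof -
  have "\<bar>LBINT x. g x\<bar> \<le> (LBINT x. C * indicator {-T..T} x)"
    using assms integrable_bounded_interval[OF assms(1,2)]
    by (intro integral_abs_bound_integral) (auto intro!: integrable_real_indicator simp: emeasure_lborel_Icc_eq)
  also have "\<dots> = C * (2 * T)" using assms by simp
  finally show ?thesis .
qed

text \<open>The indicators converge at every \<open>x\<close> other than \<open>s\<close>, a null
  set, and the absolute value of \<open>g\<close> dominates.\<close>

lemma tendsto_step_integral:
  fixes g :: "real \<Rightarrow> real"
  assumes [measurable]: "g \<in> borel_measurable borel"
    and bd: "\<And>x. \<bar>g x\<bar> \<le> C * indicator {-T..T} x"
    and a: "a \<longlonglongrightarrow> s"
  shows "(\<lambda>n. LBINT x. indicator {..<a n} x * g x) \<longlonglongrightarrow> (LBINT x. indicator {..<s} x * g x)"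
proof (rule integral_dominated_convergence)
  show "integrable lborel (\<lambda>x. \<bar>g x\<bar>)"
    using integrable_bounded_interval[OF assms(1,2)] by simp
  show "AE x in lborel. (\<lambda>n. indicator {..<a n} x * g x) \<longlonglongrightarrow> indicator {..<s} x * g x"
    using AE_lborel_singleton[of s]
  proof eventually_elim
    case (elim x)
    have "\<forall>\<^sub>F n in sequentially. indicator {..<a n} x = (indicator {..<s} x :: real)"
    proof (cases "x < s")
      case True
      then show ?thesis
        using order_tendstoD(1)[OF a True] by (auto elim: eventually_mono)
    next
      case False
      with elim have "x > s" by simp
      then show ?thesis
        using order_tendstoD(2)[OF a \<open>x > s\<close>] by (auto elim: eventually_mono)
    qed
    then show ?case
      by (intro tendsto_eventually) (auto elim: eventually_mono)
  qed
  show "AE x in lborel. norm (indicator {..<a n} x * g x) \<le> \<bar>g x\<bar>" for n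
    by (auto simp: indicator_def)
qed auto

text \<open>Here the mass concentrates: after rescaling, the average of \<open>g\<close> over the
  shrinking slice tends to \<open>g (s * t)\<close> by continuity. Convergence is asked of the
  product \<open>m n * (b n - a n)\<close>, so \<open>m\<close> itself may diverge.\<close>

lemma tendsto_sector_integral:
  fixes g :: "real \<Rightarrow> real"
  assumes g: "continuous_on UNIV g" and bd: "\<And>x. \<bar>g x\<bar> \<le> C"
    and ab: "\<And>n. a n < b n" "a \<longlonglongrightarrow> s" "b \<longlonglongrightarrow> s"
    and m: "(\<lambda>n. m n * (b n - a n)) \<longlonglongrightarrow> k" and t: "t > 0"
  shows "(\<lambda>n. m n * (LBINT x. indicator {a n * t..<b n * t} x * g x)) \<longlonglongrightarrow> k * t * g (s * t)"
proof -
  have [measurable]: "g \<in> borel_measurable borel"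
    using g by (rule borel_measurable_continuous_onI)
  have "(\<lambda>n. LBINT y. indicator {0..<1} y * g ((a n + (b n - a n) * y) * t))
      \<longlonglongrightarrow> (LBINT y::real. indicator {0..<1} y * g (s * t))"
  proof (rule integral_dominated_convergence)
    show "integrable lborel (\<lambda>y::real. C * indicator {0..<1} y)"
      by (intro integrable_mult_right integrable_real_indicator) (auto simp: emeasure_lborel_Icc_eq)
    show "AE y in lborel. (\<lambda>n. indicator {0..<1} y * g ((a n + (b n - a n) * y) * t))
        \<longlonglongrightarrow> indicator {0..<1} y * g (s * t)"
    proof (rule AE_I2)
      fix y :: real
      have "(\<lambda>n. (a n + (b n - a n) * y) * t) \<longlonglongrightarrow> (s + (s - s) * y) * t"
        by (intro tendsto_intros ab)
      then have "(\<lambda>n. g ((a n + (b n - a n) * y) * t)) \<longlonglongrightarrow> g (s * t)"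
        by (intro continuous_on_tendsto_compose[OF g]) auto
      then show "(\<lambda>n. indicator {0..<1} y * g ((a n + (b n - a n) * y) * t))
        \<longlonglongrightarrow> indicator {0..<1} y * g (s * t)" by (intro tendsto_intros)
    qed
    show "AE y in lborel. norm (indicator {0..<1} y * g ((a n + (b n - a n) * y) * t))
        \<le> C * indicator {0..<1} y" for n
      using bd by (auto simp: indicator_def)
  qed auto
  then have "(\<lambda>n. m n * (b n - a n) * t * (LBINT y. indicator {0..<1} y * g ((a n + (b n - a n) * y) * t)))
      \<longlonglongrightarrow> k * t * (LBINT y::real. indicator {0..<1} y * g (s * t))"
    by (intro tendsto_intros m)
  then show ?thesis
    using ab t by (simp add: sector_integral_rescale mult.assoc)
qed

text \<open>A bound proportional to the width stays useful after multiplication by a diverging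
  density.\<close>

lemma abs_sector_integral_le:
  fixes g :: "real \<Rightarrow> real"
  assumes [measurable]: "g \<in> borel_measurable borel" and "\<And>x. \<bar>g x\<bar> \<le> C" and "a \<le> b"
  shows "\<bar>LBINT x. indicator {a..<b} x * g x\<bar> \<le> C * (b - a)"
proof -
  have i: "integrable lborel (\<lambda>x. C * indicator {a..<b} x :: real)"
    using assms(3) by (intro integrable_mult_right integrable_real_indicator) auto
  have "integrable lborel (\<lambda>x. indicator {a..<b} x * g x)"
    by (rule Bochner_Integration.integrable_bound[OF i])
      (use assms(2) in \<open>auto simp: indicator_def intro: order_trans abs_ge_self\<close>)
  then have "\<bar>LBINT x. indicator {a..<b} x * g x\<bar> \<le> (LBINT x. C * indicator {a..<b} x)"
    by (intro integral_abs_bound_integral i) (use assms(2) in \<open>auto simp: indicator_def\<close>)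
  also have "\<dots> = C * (b - a)" using assms(3) by simp
  finally show ?thesis .
qed

section \<open>Distributional limits of three-state step functions\<close>

text \<open>The pairing splits into left state, sector and right state. On each slice with
  \<open>t > 0\<close> the outer parts converge to those of the limiting step and the sector gives
  the delta term; dominated convergence in \<open>t\<close> then integrates the slices. The lemma
  covers the density, with \<open>m\<close> diverging, as well as the velocity, with
  \<open>k = 0\<close>.\<close>

lemma pairing_tendsto_delta_sequentially:
  fixes a b m :: "nat \<Rightarrow> real"
  assumes \<phi>: "\<phi> \<in> test_functions"
    and ab: "\<And>n. a n < b n" "a \<longlonglongrightarrow> s" "b \<longlonglongrightarrow> s"
    and m: "(\<lambda>n. m n * (b n - a n)) \<longlonglongrightarrow> k"
  shows "(\<lambda>n. fun_pairing (\<lambda>t x. if x < a n * t then l else if x < b n * t then m n else r) \<phi>)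
    \<longlonglongrightarrow> fun_pairing (\<lambda>t x. if x < s * t then l else r) \<phi> + delta_pairing (\<lambda>t. t * k) s \<phi>"
proof -
  define \<psi> where "\<psi> = (\<lambda>p. indicator half_plane p * \<phi> p)"
  obtain T C where T: "T > 0" and C: "C > 0" and meas[measurable]: "\<psi> \<in> borel_measurable borel"
    and bd: "\<And>t x. \<bar>\<psi> (t, x)\<bar> \<le> C * indicator {0..T} t * indicator {-T..T} x"
    and cont: "\<And>t. continuous_on UNIV (\<lambda>x. \<psi> (t, x))"
    using test_function_extension[OF \<phi>] unfolding \<psi>_def by metis
  have meas2[measurable]: "\<psi> \<in> borel_measurable (borel \<Otimes>\<^sub>M borel)"
    using meas by (simp add: borel_prod)
  have meas_t[measurable]: "(\<lambda>x. \<psi> (t, x)) \<in> borel_measurable borel" for t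
    by measurable
  have bd1: "\<bar>\<psi> (t, x)\<bar> \<le> C * indicator {-T..T} x" for t x
    using bd[of t x] C by (auto simp: indicator_def of_bool_def split: if_splits)
  have bdi: "\<bar>indicator A x * \<psi> (t, x)\<bar> \<le> C * indicator {-T..T} x" for A x t
    using bd1[of t x] C by (cases "x \<in> A") auto
  have bd2: "\<bar>\<psi> (t, x)\<bar> \<le> C" for t x
    using bd[of t x] C by (auto simp: indicator_def of_bool_def split: if_splits)
  have \<psi>0: "\<psi> (t, x) = 0" if "t \<notin> {0..T}" for t x
    using bd[of t x] that by auto
  define I where "I = (\<lambda>z t. LBINT x. indicator {..<z * t} x * \<psi> (t, x))"
  define A where "A = (\<lambda>t. LBINT x. \<psi> (t, x))"
  define B where "B = (\<lambda>n t. LBINT x. indicator {a n * t..<b n * t} x * \<psi> (t, x))"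
  have int: "integrable lborel (\<lambda>x. indicator {..<z} x * \<psi> (t, x))" for z t
    by (rule integrable_bounded_interval[where C = C and T = T])
      (auto intro: bdi)
  have intA: "integrable lborel (\<lambda>x. \<psi> (t, x))" for t
    by (rule integrable_bounded_interval[where C = C and T = T]) (auto intro: bd1)
  have intB: "integrable lborel (\<lambda>x. indicator {y..<z} x * \<psi> (t, x))" for y z t
    by (rule integrable_bounded_interval[where C = C and T = T])
      (auto intro: bdi)
  have meas_step: "(\<lambda>p. indicator {..<z * fst p} (snd p) * \<psi> (fst p, snd p)) \<in> borel_measurable (borel \<Otimes>\<^sub>M borel)" for z
    unfolding indicator_def lessThan_iff by measurable
  have meas_sector: "(\<lambda>p. indicator {y * fst p..<z * fst p} (snd p) * \<psi> (fst p, snd p)) \<in> borel_measurable (borel \<Otimes>\<^sub>M borel)" for y z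
    unfolding indicator_def atLeastLessThan_iff by measurable
  \<comment> \<open>Measurability of parameter integrals refers to a product with
    \<open>lborel\<close>, while the integrands were checked over the product of
    \<open>borel\<close> with itself; both have the same measurable sets.\<close>
  have sets_eq: "sets ((borel :: real measure) \<Otimes>\<^sub>M (lborel :: real measure)) =
      sets (borel \<Otimes>\<^sub>M borel)" for M
    by (intro sets_pair_measure_cong) auto
  have [measurable]: "I z \<in> borel_measurable borel" for z
    unfolding I_def by (intro lborel.borel_measurable_lebesgue_integral) (simp only: meas_step case_prod_unfold measurable_cong_sets[OF sets_eq refl])
  have [measurable]: "A \<in> borel_measurable borel"
    unfolding A_def by (intro lborel.borel_measurable_lebesgue_integral) (simp only: meas2 case_prod_unfold prod.collapse measurable_cong_sets[OF sets_eq refl])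
  have [measurable]: "B n \<in> borel_measurable borel" for n
    unfolding B_def by (intro lborel.borel_measurable_lebesgue_integral) (simp only: meas_sector case_prod_unfold measurable_cong_sets[OF sets_eq refl])
  have mono: "a n * t \<le> b n * t" if "t \<ge> 0" for n t
    using that ab(1)[of n] by (intro mult_right_mono) auto

  \<comment> \<open>For \<open>t \<ge> 0\<close> the sector edges are ordered, so the nested
    conditional is a sum of three indicators. Time can be cut at \<open>T\<close> because
    \<open>\<psi>\<close> vanishes afterwards.\<close>
  have pair: "fun_pairing (\<lambda>t x. if x < a n * t then l else if x < b n * t then m n else r) \<phi> =
      (LBINT t. indicator {0..T} t * (l * I (a n) t + m n * B n t + r * (A t - I (b n) t)))" for n
    unfolding fun_pairing_def set_lebesgue_integral_def
  proof (rule Bochner_Integration.integral_cong[OF refl])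
    fix t :: real
    show "indicator {0..} t *\<^sub>R (LBINT x. (if x < a n * t then l else if x < b n * t then m n else r) * \<phi> (t, x))
      = indicator {0..T} t * (l * I (a n) t + m n * B n t + r * (A t - I (b n) t))"
    proof (cases "t \<in> {0..}")
      case t: True
      have "(LBINT x. (if x < a n * t then l else if x < b n * t then m n else r) * \<phi> (t, x)) =
          (LBINT x. l * (indicator {..<a n * t} x * \<psi> (t, x))
            + m n * (indicator {a n * t..<b n * t} x * \<psi> (t, x))
            + r * (\<psi> (t, x) - indicator {..<b n * t} x * \<psi> (t, x)))"
        using t mono[of t n] by (intro Bochner_Integration.integral_cong refl)
          (auto simp: \<psi>_def half_plane_def indicator_def)
      also have "\<dots> = l * I (a n) t + m n * B n t + r * (A t - I (b n) t)"
        unfolding I_def A_def B_def using int intA intB by simp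
      finally show ?thesis using t \<psi>0 by (auto simp: indicator_def I_def A_def B_def)
    qed auto
  qed
  have pair0: "fun_pairing (\<lambda>t x. if x < s * t then l else r) \<phi> =
      (LBINT t. indicator {0..T} t * (l * I s t + r * (A t - I s t)))"
    unfolding fun_pairing_def set_lebesgue_integral_def
  proof (rule Bochner_Integration.integral_cong[OF refl])
    fix t :: real
    show "indicator {0..} t *\<^sub>R (LBINT x. (if x < s * t then l else r) * \<phi> (t, x))
      = indicator {0..T} t * (l * I s t + r * (A t - I s t))"
    proof (cases "t \<in> {0..}")
      case t: True
      have "(LBINT x. (if x < s * t then l else r) * \<phi> (t, x)) =
          (LBINT x. l * (indicator {..<s * t} x * \<psi> (t, x))
            + r * (\<psi> (t, x) - indicator {..<s * t} x * \<psi> (t, x)))"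
        using t by (intro Bochner_Integration.integral_cong refl)
          (auto simp: \<psi>_def half_plane_def indicator_def)
      also have "\<dots> = l * I s t + r * (A t - I s t)"
        unfolding I_def A_def using int intA by simp
      finally show ?thesis using t \<psi>0 by (auto simp: indicator_def I_def A_def)
    qed auto
  qed
  have delta: "delta_pairing (\<lambda>t. t * k) s \<phi> = (LBINT t. indicator {0..T} t * (k * t * \<psi> (t, s * t)))"
    unfolding delta_pairing_def set_lebesgue_integral_def
  proof (rule Bochner_Integration.integral_cong[OF refl])
    show "indicator {0..} t *\<^sub>R (t * k * \<phi> (t, s * t)) = indicator {0..T} t * (k * t * \<psi> (t, s * t))"
      for t :: real
      using \<psi>0[of t "s * t"] by (auto simp: \<psi>_def half_plane_def indicator_def split: if_splits)
  qed

  have I_le: "\<bar>I z t\<bar> \<le> C * (2 * T)" for z t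
    unfolding I_def by (rule abs_integral_bounded_interval) (auto intro: bdi T)
  have A_le: "\<bar>A t\<bar> \<le> C * (2 * T)" for t
    unfolding A_def by (rule abs_integral_bounded_interval) (use bd1 T in auto)
  \<comment> \<open>A convergent sequence is bounded: \<open>D\<close> controls the mass rate of the
    sector uniformly in \<open>n\<close>, even if \<open>m n\<close> is unbounded.\<close>
  obtain D where D: "D > 0" "\<And>n. \<bar>m n * (b n - a n)\<bar> \<le> D"
    using convergent_imp_Bseq[OF convergentI[OF m]] by (auto simp: Bseq_def)
  have B_le: "\<bar>m n * B n t\<bar> \<le> D * C * T" if "t \<in> {0..T}" for n t
  proof -
    have "\<bar>B n t\<bar> \<le> C * (b n * t - a n * t)"
      unfolding B_def using that by (intro abs_sector_integral_le mono) (auto intro: bd2)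
    then have "\<bar>m n * B n t\<bar> \<le> \<bar>m n\<bar> * (C * (b n * t - a n * t))"
      by (simp add: abs_mult mult_left_mono)
    moreover have "\<bar>b n - a n\<bar> = b n - a n" using ab(1)[of n] by simp
    then have "\<bar>m n\<bar> * (C * (b n * t - a n * t)) = \<bar>m n * (b n - a n)\<bar> * C * t"
      by (simp only: abs_mult) (simp add: algebra_simps)
    moreover have "\<bar>m n * (b n - a n)\<bar> * C * t \<le> D * C * T"
      using that D C by (intro mult_mono) auto
    ultimately show ?thesis by linarith
  qed
  \<comment> \<open>The three summands bound the left, sector and right contributions.\<close>
  define E where "E = \<bar>l\<bar> * (C * (2 * T)) + D * C * T + \<bar>r\<bar> * (C * (2 * T) + C * (2 * T))"
  have i: "integrable lborel (\<lambda>t::real. E * indicator {0..T} t)"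
    by (intro integrable_mult_right integrable_real_indicator) (auto simp: emeasure_lborel_Icc_eq)
  have "(\<lambda>n. LBINT t. indicator {0..T} t * (l * I (a n) t + m n * B n t + r * (A t - I (b n) t)))
      \<longlonglongrightarrow> (LBINT t. indicator {0..T} t * (l * I s t + k * t * \<psi> (t, s * t) + r * (A t - I s t)))"
  proof (rule integral_dominated_convergence[OF _ _ i])
    show "AE t in lborel. (\<lambda>n. indicator {0..T} t * (l * I (a n) t + m n * B n t + r * (A t - I (b n) t)))
        \<longlonglongrightarrow> indicator {0..T} t * (l * I s t + k * t * \<psi> (t, s * t) + r * (A t - I s t))"
      \<comment> \<open>The time \<open>t = 0\<close> is discarded as a null set, since the sector
        limit is available for \<open>t > 0\<close>.\<close>
      using AE_lborel_singleton[of 0]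
    proof eventually_elim
      case (elim t)
      show ?case
      proof (cases "t \<in> {0..T}")
        case True
        with elim have t: "t > 0" by auto
        have step: "(\<lambda>n. I (z n) t) \<longlonglongrightarrow> I s t" if "z \<longlonglongrightarrow> s" for z
          unfolding I_def
          by (rule tendsto_step_integral[where C = C and T = T])
            (auto intro: bd1 tendsto_mult_right that)
        have "(\<lambda>n. m n * B n t) \<longlonglongrightarrow> k * t * \<psi> (t, s * t)"
          unfolding B_def
          by (rule tendsto_sector_integral[where C = C and g = "\<lambda>x. \<psi> (t, x)"])
            (use cont bd2 ab m t in auto)
        then have "(\<lambda>n. l * I (a n) t + m n * B n t + r * (A t - I (b n) t))
            \<longlonglongrightarrow> l * I s t + k * t * \<psi> (t, s * t) + r * (A t - I s t)"
          by (intro tendsto_add[OF tendsto_add[OF tendsto_mult_left[OF step[OF ab(2)]]]]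
              tendsto_mult_left[OF tendsto_diff] tendsto_const step ab)
        then show ?thesis by (rule tendsto_mult_left)
      qed simp
    qed
    show "AE t in lborel. norm (indicator {0..T} t * (l * I (a n) t + m n * B n t + r * (A t - I (b n) t)))
        \<le> E * indicator {0..T} t" for n
    proof (rule AE_I2)
      fix t :: real
      show "norm (indicator {0..T} t * (l * I (a n) t + m n * B n t + r * (A t - I (b n) t)))
        \<le> E * indicator {0..T} t"
      proof (cases "t \<in> {0..T}")
        case True
        have "\<bar>l * I (a n) t\<bar> \<le> \<bar>l\<bar> * (C * (2 * T))"
          unfolding abs_mult using I_le by (intro mult_left_mono) auto
        moreover have "\<bar>A t - I (b n) t\<bar> \<le> C * (2 * T) + C * (2 * T)"
          using A_le[of t] I_le[of "b n" t] by linarith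
        then have "\<bar>r * (A t - I (b n) t)\<bar> \<le> \<bar>r\<bar> * (C * (2 * T) + C * (2 * T))"
          unfolding abs_mult by (intro mult_left_mono) auto
        ultimately have "\<bar>l * I (a n) t + m n * B n t + r * (A t - I (b n) t)\<bar> \<le> E"
          unfolding E_def using B_le[OF True, of n] by linarith
        then show ?thesis using True by simp
      qed simp
    qed
  qed measurable
  also have "(LBINT t. indicator {0..T} t * (l * I s t + k * t * \<psi> (t, s * t) + r * (A t - I s t))) =
      (LBINT t. indicator {0..T} t * (l * I s t + r * (A t - I s t))
        + indicator {0..T} t * (k * t * \<psi> (t, s * t)))"
    by (intro Bochner_Integration.integral_cong refl) (simp add: algebra_simps)
  also have "\<dots> = fun_pairing (\<lambda>t x. if x < s * t then l else r) \<phi> + delta_pairing (\<lambda>t. t * k) s \<phi>"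
    unfolding pair0 delta
  proof (rule Bochner_Integration.integral_add)
    define E1 where "E1 = \<bar>l\<bar> * (C * (2 * T)) + \<bar>r\<bar> * (C * (2 * T) + C * (2 * T))"
    have bnd: "\<bar>l * I s t + r * (A t - I s t)\<bar> \<le> E1" for t
    proof -
      have "\<bar>l * I s t\<bar> \<le> \<bar>l\<bar> * (C * (2 * T))"
        unfolding abs_mult using I_le by (intro mult_left_mono) auto
      moreover have "\<bar>A t - I s t\<bar> \<le> C * (2 * T) + C * (2 * T)"
        using A_le[of t] I_le[of s t] by linarith
      then have "\<bar>r * (A t - I s t)\<bar> \<le> \<bar>r\<bar> * (C * (2 * T) + C * (2 * T))"
        unfolding abs_mult by (intro mult_left_mono) auto
      ultimately show ?thesis unfolding E1_def by linarith
    qed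
    show "integrable lborel (\<lambda>t. indicator {0..T} t * (l * I s t + r * (A t - I s t)))"
      by (rule integrable_bounded_interval[where C = E1 and T = T])
        (use bnd order_trans[OF abs_ge_zero bnd] T in \<open>auto simp: indicator_def\<close>)
    have bnd2: "\<bar>k * t * \<psi> (t, s * t)\<bar> \<le> \<bar>k\<bar> * T * C" if "t \<in> {0..T}" for t
      unfolding abs_mult using that C bd2 by (intro mult_mono) auto
    show "integrable lborel (\<lambda>t. indicator {0..T} t * (k * t * \<psi> (t, s * t)))"
      by (rule integrable_bounded_interval[where C = "\<bar>k\<bar> * T * C" and T = T])
        (use bnd2 T C in \<open>auto simp: indicator_def\<close>)
  qed
  finally show ?thesis by (simp add: pair)
qed

text \<open>Limits at a real point can be tested along sequences. The order of the edges holds only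
  eventually, so finitely many terms are dropped before the sequential version applies.\<close>

lemma pairing_tendsto_delta:
  fixes a b m :: "real \<Rightarrow> real"
  assumes \<phi>: "\<phi> \<in> test_functions"
    and ab: "\<forall>\<^sub>F \<gamma> in at c within S. a \<gamma> < b \<gamma>" "(a \<longlongrightarrow> s) (at c within S)" "(b \<longlongrightarrow> s) (at c within S)"
    and m: "((\<lambda>\<gamma>. m \<gamma> * (b \<gamma> - a \<gamma>)) \<longlongrightarrow> k) (at c within S)"
  shows "((\<lambda>\<gamma>. fun_pairing (\<lambda>t x. if x < a \<gamma> * t then l else if x < b \<gamma> * t then m \<gamma> else r) \<phi>)
    \<longlongrightarrow> fun_pairing (\<lambda>t x. if x < s * t then l else r) \<phi> + delta_pairing (\<lambda>t. t * k) s \<phi>) (at c within S)"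
  unfolding tendsto_at_iff_sequentially comp_def
proof (intro allI impI)
  fix X :: "nat \<Rightarrow> real"
  assume X: "\<forall>i. X i \<in> S - {c}" "X \<longlonglongrightarrow> c"
  then have lim: "filterlim X (at c within S) sequentially"
    by (auto simp: filterlim_at)
  then have "\<forall>\<^sub>F n in sequentially. a (X n) < b (X n)"
    using ab(1) by (auto simp: filterlim_iff)
  then obtain N where N: "\<And>n. n \<ge> N \<Longrightarrow> a (X n) < b (X n)"
    by (auto simp: eventually_sequentially)
  have lim': "filterlim (\<lambda>n. X (n + N)) (at c within S) sequentially"
    by (rule filterlim_compose[OF lim filterlim_add_const_nat_at_top])
  show "(\<lambda>n. fun_pairing (\<lambda>t x. if x < a (X n) * t then l else if x < b (X n) * t then m (X n) else r) \<phi>)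
    \<longlonglongrightarrow> fun_pairing (\<lambda>t x. if x < s * t then l else r) \<phi> + delta_pairing (\<lambda>t. t * k) s \<phi>"
    by (rule LIMSEQ_offset[of _ N], rule pairing_tendsto_delta_sequentially[OF \<phi>])
      (use N in auto, auto intro: filterlim_compose[OF _ lim'] ab m)
qed

text \<open>The line meets each time slice in one point, a null set; this disposes of the value that
  \<open>u0\<close> takes on the line.\<close>

lemma fun_pairing_cong_line:
  assumes "\<And>t x. x \<noteq> s * t \<Longrightarrow> f t x = g t x"
  shows "fun_pairing f \<phi> = fun_pairing g \<phi>"
proof -
  have "(LBINT x. f t x * \<phi> (t, x)) = (LBINT x. g t x * \<phi> (t, x))" for t
    by (rule integral_discrete_difference[of "{s * t}"]) (use assms in auto)
  then show ?thesis by (simp add: fun_pairing_def)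
qed

text \<open>The first conjunct keeps the limits from being vacuous: region IV contains the right
  state for all \<gamma> slightly above 1, so the filter of the limits is nontrivial.\<close>

theorem theorem4p4:
  fixes \<rho>m um \<rho>p up \<sigma> :: real
    and w :: "real \<Rightarrow> real"
    and \<rho>0 u0 :: "real \<Rightarrow> real \<Rightarrow> real"
  assumes "\<rho>m > 0" and "\<rho>p > 0" and "up < um"
    and "\<sigma> = (um + up) / 2"
    and "w = (\<lambda>t. t * (\<sigma> * (\<rho>p - \<rho>m) - (\<rho>p * up - \<rho>m * um)))"
    and "\<rho>0 = (\<lambda>t x. if x < \<sigma> * t then \<rho>m else \<rho>p)"
    and "u0 = (\<lambda>t x. if x < \<sigma> * t then um else if x = \<sigma> * t then \<sigma> else up)"
  shows "(\<forall>\<^sub>F \<gamma> in at_right 1. (\<rho>p, up) \<in> region_IV \<gamma> (\<rho>m, um)) \<and>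
    (\<forall>\<phi>\<in>test_functions.
      ((\<lambda>\<gamma>. fun_pairing (\<lambda>t x. fst (two_shock_solution \<gamma> (\<rho>m, um) (\<rho>p, up) t x)) \<phi>)
         \<longlongrightarrow> fun_pairing \<rho>0 \<phi> + delta_pairing w \<sigma> \<phi>)
        (at 1 within {\<gamma> \<in> {1<..<2}. (\<rho>p, up) \<in> region_IV \<gamma> (\<rho>m, um)}) \<and>
      ((\<lambda>\<gamma>. fun_pairing (\<lambda>t x. snd (two_shock_solution \<gamma> (\<rho>m, um) (\<rho>p, up) t x)) \<phi>)
         \<longlongrightarrow> fun_pairing u0 \<phi>)
        (at 1 within {\<gamma> \<in> {1<..<2}. (\<rho>p, up) \<in> region_IV \<gamma> (\<rho>m, um)}))"
proof -
  define S where "S = {\<gamma> \<in> {1<..<2}. (\<rho>p, up) \<in> region_IV \<gamma> (\<rho>m, um)}"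
  define F where "F = at 1 within S"
  define M where "M = (\<lambda>\<gamma>. intermediate_state \<gamma> (\<rho>m, um) (\<rho>p, up))"
  define r where "r = (\<lambda>\<gamma>. fst (M \<gamma>))"
  define v where "v = (\<lambda>\<gamma>. snd (M \<gamma>))"
  define s1 where "s1 = (\<lambda>\<gamma>. shock_speed (\<rho>m, um) (M \<gamma>))"
  define s2 where "s2 = (\<lambda>\<gamma>. shock_speed (M \<gamma>) (\<rho>p, up))"
  define k where "k = \<sigma> * (\<rho>p - \<rho>m) - (\<rho>p * up - \<rho>m * um)"
  have M: "M = (\<lambda>\<gamma>. (r \<gamma>, v \<gamma>))" by (simp add: r_def v_def)
  have "\<forall>\<^sub>F \<gamma> in at_right 1. jump \<gamma> \<rho>m \<rho>p < um - up"
    using order_tendstoD(2)[OF tendsto_jump_at_right_1[OF assms(1,2)]] assms(3) by simp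
  then have region: "\<forall>\<^sub>F \<gamma> in at_right 1. (\<rho>p, up) \<in> region_IV \<gamma> (\<rho>m, um)"
    by eventually_elim (use assms(1,2) in \<open>simp add: region_IV_iff_jump\<close>)

  have F: "F \<le> at_right 1" unfolding F_def by (rule at_le) (auto simp: S_def)
  have "\<forall>\<^sub>F \<gamma> in F. \<gamma> \<in> S" by (simp add: F_def eventually_at_filter)
  then have ev: "\<forall>\<^sub>F \<gamma> in F. r \<gamma> > max \<rho>m \<rho>p \<and> jump \<gamma> \<rho>m (r \<gamma>) + jump \<gamma> \<rho>p (r \<gamma>) = um - up"
    and evv: "\<forall>\<^sub>F \<gamma> in F. um - jump \<gamma> \<rho>m (r \<gamma>) = v \<gamma>"
    by (eventually_elim,
        use intermediate_state_spec[OF _ assms(1,2)] in \<open>simp add: S_def r_def v_def M_def\<close>)+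
  have d: "um - up > 0" using assms(3) by simp
  have top: "filterlim r at_top F"
    by (rule intermediate_density_at_top[OF F assms(1,2) d ev])
  \<comment> \<open>Each shock takes half of the total drop in the limit, so the intermediate
    velocity tends to the mean \<sigma>.\<close>
  have "((\<lambda>\<gamma>. um - jump \<gamma> \<rho>m (r \<gamma>)) \<longlongrightarrow> um - (um - up) / 2) F"
    by (intro tendsto_intros tendsto_jump_half[OF F assms(1,2) d ev])
  then have v: "(v \<longlongrightarrow> \<sigma>) F"
    using evv Lim_transform_eventually by (fastforce simp: assms(4) field_simps)
  have s1: "(s1 \<longlongrightarrow> \<sigma>) F"
    unfolding s1_def M by (rule tendsto_shock_speed[OF top v])
  have s2: "(s2 \<longlongrightarrow> \<sigma>) F"
    unfolding s2_def M shock_speed_commute[of _ "(\<rho>p, up)"] by (rule tendsto_shock_speed[OF top v])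

  \<comment> \<open>The product \<open>r \<gamma> * (s2 \<gamma> - s1 \<gamma>)\<close> is of the
    form infinity times zero; the right-hand side of \<open>shock_sector_mass\<close> has an evident
    limit.\<close>
  have "((\<lambda>\<gamma>. s2 \<gamma> * \<rho>p - s1 \<gamma> * \<rho>m - (\<rho>p * up - \<rho>m * um)) \<longlongrightarrow>
      \<sigma> * \<rho>p - \<sigma> * \<rho>m - (\<rho>p * up - \<rho>m * um)) F"
    by (intro tendsto_intros s1 s2)
  then have "((\<lambda>\<gamma>. s2 \<gamma> * \<rho>p - s1 \<gamma> * \<rho>m - (\<rho>p * up - \<rho>m * um)) \<longlongrightarrow> k) F"
    by (simp add: k_def right_diff_distrib)
  moreover have "\<forall>\<^sub>F \<gamma> in F. s2 \<gamma> * \<rho>p - s1 \<gamma> * \<rho>m - (\<rho>p * up - \<rho>m * um) = r \<gamma> * (s2 \<gamma> - s1 \<gamma>)"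
    using ev by eventually_elim (auto simp: s1_def s2_def M shock_sector_mass)
  ultimately have mass: "((\<lambda>\<gamma>. r \<gamma> * (s2 \<gamma> - s1 \<gamma>)) \<longlongrightarrow> k) F"
    by (rule Lim_transform_eventually)
  \<comment> \<open>Positivity of the limiting mass orders the shocks: since
    \<open>r \<gamma>\<close> is positive, a positive product forces
    \<open>s1 \<gamma> < s2 \<gamma>\<close> for \<gamma> near 1.\<close>
  have "k = (um - up) / 2 * (\<rho>p + \<rho>m)"
    by (simp add: k_def assms(4) field_simps)
  also have "\<dots> > 0" using assms(1-3) by (intro mult_pos_pos) auto
  finally have "k > 0" .
  then have "\<forall>\<^sub>F \<gamma> in F. r \<gamma> * (s2 \<gamma> - s1 \<gamma>) > 0"
    by (rule order_tendstoD(1)[OF mass])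
  with ev have less: "\<forall>\<^sub>F \<gamma> in F. s1 \<gamma> < s2 \<gamma>"
    by eventually_elim (use assms(1) in \<open>auto simp: zero_less_mult_iff\<close>)
  \<comment> \<open>The intermediate velocity stays bounded while the sector closes, so the velocity
    has delta weight 0.\<close>
  have "((\<lambda>\<gamma>. v \<gamma> * (s2 \<gamma> - s1 \<gamma>)) \<longlongrightarrow> \<sigma> * (\<sigma> - \<sigma>)) F"
    by (intro tendsto_intros v s1 s2)
  then have mom: "((\<lambda>\<gamma>. v \<gamma> * (s2 \<gamma> - s1 \<gamma>)) \<longlongrightarrow> 0) F" by simp

  have sol: "fst (two_shock_solution \<gamma> (\<rho>m, um) (\<rho>p, up) t x) =
      (if x < s1 \<gamma> * t then \<rho>m else if x < s2 \<gamma> * t then r \<gamma> else \<rho>p)"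
    "snd (two_shock_solution \<gamma> (\<rho>m, um) (\<rho>p, up) t x) =
      (if x < s1 \<gamma> * t then um else if x < s2 \<gamma> * t then v \<gamma> else up)" for \<gamma> t x
    by (auto simp: two_shock_solution_def Let_def s1_def s2_def r_def v_def M_def)
  have "((\<lambda>\<gamma>. fun_pairing (\<lambda>t x. fst (two_shock_solution \<gamma> (\<rho>m, um) (\<rho>p, up) t x)) \<phi>)
        \<longlongrightarrow> fun_pairing \<rho>0 \<phi> + delta_pairing w \<sigma> \<phi>) F"
    if "\<phi> \<in> test_functions" for \<phi>
    using pairing_tendsto_delta[OF that less[unfolded F_def] s1[unfolded F_def] s2[unfolded F_def]
        mass[unfolded F_def], of \<rho>m \<rho>p]
    by (simp add: sol F_def k_def assms(5,6))
  moreover have "((\<lambda>\<gamma>. fun_pairing (\<lambda>t x. snd (two_shock_solution \<gamma> (\<rho>m, um) (\<rho>p, up) t x)) \<phi>)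
        \<longlongrightarrow> fun_pairing u0 \<phi>) F"
    if "\<phi> \<in> test_functions" for \<phi>
  proof -
    have "fun_pairing u0 \<phi> = fun_pairing (\<lambda>t x. if x < \<sigma> * t then um else up) \<phi>"
      by (rule fun_pairing_cong_line[of \<sigma>]) (simp add: assms(7))
    then show ?thesis
      using pairing_tendsto_delta[OF that less[unfolded F_def] s1[unfolded F_def] s2[unfolded F_def]
          mom[unfolded F_def], of um up]
      by (simp add: sol F_def delta_pairing_def)
  qed
  ultimately show ?thesis
    using region unfolding F_def S_def by blast
qed

end
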